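(* For any positive integers $n,r$ with $r\le n^2$, there exists an $n$-vertex directed graph $G$ together with a set $\mathcal{P}$ of $r$ vertex pairs such that any 2-fault-tolerant reachability oracle of $G$ for $\mathcal{P}$ must have size $\Omega(n\sqrt{|\mathcal{P}|})$ bits.
   Context: For a directed graph $G=(V,E)$ and $\mathcal{P}\subseteq V\times V$, a $k$-fault-tolerant reachability oracle of $G$ for $\mathcal{P}$ is a data structure that, given any pair $(s,t)\in\mathcal{P}$ and any set $F\subseteq E$ of at most $k$ edges, decides whether $t$ is reachable from $s$ in the graph $G\setminus F$ obtained by deleting the edges of $F$. *)

theory Defs
  imports Complex_Main "Graph_Theory.Pair_Digraph"
begin

definition delete_edges :: "'a pair_pre_digraph \<Rightarrow> ('a \<times> 'a) set \<Rightarrow> 'a pair_pre_digraph" where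
  "delete_edges G F = G\<lparr>parcs := parcs G - F\<rparr>"

(* A query procedure reads the stored bit string, the queried pair (s,t) and the
   set F of failed edges.  It is an arbitrary function: no computability or
   running-time restriction is imposed. *)
type_synonym 'a query_procedure = "bool list \<Rightarrow> 'a \<times> 'a \<Rightarrow> ('a \<times> 'a) set \<Rightarrow> bool"

(* With respect to the query procedure Q, the bit string D is a k-fault-tolerant
   reachability oracle of G for P.  The answers on pairs outside P and on other
   sets F are unconstrained.  The size of the oracle in bits is length D;
   Q itself is not charged. *)
definition ft_reachability_oracle ::
    "nat \<Rightarrow> 'a pair_pre_digraph \<Rightarrow> ('a \<times> 'a) set \<Rightarrow> 'a query_procedure \<Rightarrow> bool list \<Rightarrow> bool" where
  "ft_reachability_oracle k G P Q D \<longleftrightarrow>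
     (\<forall>(s, t) \<in> P. \<forall>F. F \<subseteq> parcs G \<and> finite F \<and> card F \<le> k \<longrightarrow>
        (Q D (s, t) F \<longleftrightarrow> s \<rightarrow>\<^sup>*\<^bsub>with_proj (delete_edges G F)\<^esub> t))"

end

theory Submission
  imports Defs
begin

text \<open>
  The vertices below \<open>2km\<close> are split into \<open>2k\<close> blocks of length \<open>m\<close>, each carrying a directed path.
  The first \<open>k\<close> blocks are source blocks, the last \<open>k\<close> are target blocks, and any set of arcs from
  a vertex of a source block to the vertex in the same position of a target block may be added.
  To test such an arc \<open>(u, v)\<close>, cut the path of \<open>u\<close> just after \<open>u\<close> and the path of \<open>v\<close> just before
  \<open>v\<close>: the start of the block of \<open>u\<close> then reaches only positions up to that of \<open>u\<close>, and the end
  of the block of \<open>v\<close> is reached only from positions from that of \<open>v\<close> on, so \<open>(u, v)\<close> is the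
  only arc that can connect the two. Hence \<open>k\<^sup>2\<close> pairs encode \<open>k\<^sup>2m\<close> independent bits, and
  \<open>k \<approx> sqrt r\<close>, \<open>m \<approx> n / 2k\<close> gives the bound.
\<close>

section \<open>Counting short bit strings\<close>

lemma card_bool_lists_shorter: "card {D :: bool list. length D < N} < 2 ^ N"
proof (cases N)
  case (Suc N')
  have "{D :: bool list. length D < N} = {D. set D \<subseteq> UNIV \<and> length D \<le> N'}"
    using Suc by auto
  then have "card {D :: bool list. length D < N} = (\<Sum>i\<le>N'. 2 ^ i)"
    using card_lists_length_le[of "UNIV :: bool set" N'] by simp
  also have "\<dots> = 2 ^ N - 1"
    using Suc sum_power2[of N] by (simp only: atLeast0LessThan lessThan_Suc_atMost)
  also have "\<dots> < 2 ^ N"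
    by simp
  finally show ?thesis .
qed simp

text \<open>Pigeonhole: choosing a code shorter than \<open>N\<close> for each element of
  \<open>A\<close> would inject at least \<open>2 ^ N\<close> elements into fewer than
  \<open>2 ^ N\<close> strings. \<open>R\<close> is a relation because one graph may have many valid
  oracles.\<close>

lemma exists_long_code:
  fixes R :: "'a \<Rightarrow> bool list \<Rightarrow> bool"
  assumes "finite A" "2 ^ N \<le> card A"
    and inj: "\<And>a b D. a \<in> A \<Longrightarrow> b \<in> A \<Longrightarrow> R a D \<Longrightarrow> R b D \<Longrightarrow> a = b"
  shows "\<exists>a\<in>A. \<forall>D. R a D \<longrightarrow> N \<le> length D"
proof (rule ccontr)
  assume "\<not> ?thesis"
  then have "\<forall>a\<in>A. \<exists>D. R a D \<and> length D < N"
    by (meson not_le)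
  then obtain f where f: "\<And>a. a \<in> A \<Longrightarrow> R a (f a) \<and> length (f a) < N"
    by metis
  have fin: "finite {D :: bool list. length D < N}"
    using finite_lists_length_le[of "UNIV :: bool set" N]
    by (rule finite_subset[rotated]) auto
  have "inj_on f A"
    using f inj by (metis inj_onI)
  then have "card A \<le> card {D :: bool list. length D < N}"
    using f fin by (intro card_inj_on_le) auto
  then show False
    using assms(2) card_bool_lists_shorter[of N] by linarith
qed

section \<open>The block graphs and their probes\<close>

definition path_arcs :: "nat \<Rightarrow> nat \<Rightarrow> (nat \<times> nat) set" where
  "path_arcs k m = {(w, Suc w) | w. Suc w < 2 * k * m \<and> Suc w mod m \<noteq> 0}"

definition bit_arcs :: "nat \<Rightarrow> nat \<Rightarrow> (nat \<times> nat) set" where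
  "bit_arcs k m = {(u, v). u < k * m \<and> k * m \<le> v \<and> v < 2 * k * m \<and> u mod m = v mod m}"

definition block_graph :: "nat \<Rightarrow> nat \<Rightarrow> nat \<Rightarrow> (nat \<times> nat) set \<Rightarrow> nat pair_pre_digraph" where
  "block_graph n k m B = \<lparr>pverts = {..<n}, parcs = path_arcs k m \<union> B\<rparr>"

definition block_start :: "nat \<Rightarrow> nat \<Rightarrow> nat" where
  "block_start m u = u div m * m"

definition block_end :: "nat \<Rightarrow> nat \<Rightarrow> nat" where
  "block_end m v = v div m * m + (m - 1)"

text \<open>The intersection settles the boundary cases: no path arc leaves the last vertex of a
  block or enters its first, and for \<open>m = 1\<close> the pair \<open>(u, Suc u)\<close> can be
  the very bit arc under test. The set does not depend on \<open>B\<close>, so a decoder can form it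
  without knowing the graph.\<close>

definition cut_arcs :: "nat \<Rightarrow> nat \<Rightarrow> nat \<Rightarrow> nat \<Rightarrow> (nat \<times> nat) set" where
  "cut_arcs k m u v = {(u, Suc u), (v - 1, v)} \<inter> path_arcs k m"

definition probe_pairs :: "nat \<Rightarrow> nat \<Rightarrow> (nat \<times> nat) set" where
  "probe_pairs k m = (\<lambda>(u, v). (block_start m u, block_end m v)) ` bit_arcs k m"

lemma finite_bit_arcs: "finite (bit_arcs k m)"
  by (rule finite_subset[of _ "{..<k * m} \<times> {..<2 * k * m}"]) (auto simp: bit_arcs_def)

lemma block_start_le: "block_start m u \<le> u"
  by (simp add: block_start_def)

lemma block_end_ge:
  assumes "0 < m"
  shows "v \<le> block_end m v"
  using assms mod_less_divisor[of m v] div_mult_mod_eq[of v m]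
  unfolding block_end_def by linarith

lemma div_eq_if_between_block_ends:
  assumes "0 < m" "block_start m u \<le> w" "w \<le> block_end m u"
  shows "w div m = u div m"
  using assms by (intro div_nat_eqI) (auto simp: block_start_def block_end_def mult.commute)

lemma pair_digraph_block_graph:
  assumes "2 * k * m \<le> n" "B \<subseteq> bit_arcs k m"
  shows "pair_digraph (block_graph n k m B)"
proof
  have "path_arcs k m \<subseteq> {..<n} \<times> {..<n}" "B \<subseteq> {..<n} \<times> {..<n}"
    using assms by (auto simp: path_arcs_def bit_arcs_def)
  then have sub: "parcs (block_graph n k m B) \<subseteq> {..<n} \<times> {..<n}"
    by (simp add: block_graph_def)
  then show "finite (parcs (block_graph n k m B))"
    by (rule finite_subset) simp
  show "finite (pverts (block_graph n k m B))"
    by (simp add: block_graph_def)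
  fix e assume e: "e \<in> parcs (block_graph n k m B)"
  with sub show "fst e \<in> pverts (block_graph n k m B)" "snd e \<in> pverts (block_graph n k m B)"
    by (auto simp: block_graph_def)
  show "fst e \<noteq> snd e"
    using e assms(2) by (auto simp: block_graph_def path_arcs_def bit_arcs_def)
qed

section \<open>Reachability after the two cuts\<close>

lemma reachable_along_successors:
  fixes G :: "nat pair_pre_digraph"
  assumes "pair_wf_digraph G" "x \<le> y" "y \<in> pverts G"
    and "\<And>w. x \<le> w \<Longrightarrow> w < y \<Longrightarrow> (w, Suc w) \<in> parcs G"
  shows "x \<rightarrow>\<^sup>*\<^bsub>with_proj G\<^esub> y"
proof -
  interpret pair_wf_digraph G by fact
  show ?thesis
    using assms(2-)
  proof (induction rule: inc_induct)
    case base
    then show ?case by simp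
  next
    case (step w)
    then have "(w, Suc w) \<in> parcs G" by simp
    moreover have "Suc w \<rightarrow>\<^sup>*\<^bsub>with_proj G\<^esub> y" using step by simp
    ultimately show ?case by (rule adj_reachable_trans)
  qed
qed

text \<open>Serves to refute reachability: it suffices to find an arc-closed property that holds at
  the source and fails at the target.\<close>

lemma reachable_closed:
  assumes "x \<rightarrow>\<^sup>*\<^bsub>with_proj G\<^esub> y" "I x"
    and "\<And>a b. (a, b) \<in> parcs G \<Longrightarrow> I a \<Longrightarrow> I b"
  shows "I y"
  using assms(1,2) unfolding reachable_def
  by (induction rule: rtrancl_on.induct) (auto intro: assms(3))

lemma reachable_after_cut_iff:
  assumes m: "0 < m" and n: "2 * k * m \<le> n" and B: "B \<subseteq> bit_arcs k m"
    and uv: "(u, v) \<in> bit_arcs k m"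
  shows "block_start m u
      \<rightarrow>\<^sup>*\<^bsub>with_proj (delete_edges (block_graph n k m B) (cut_arcs k m u v))\<^esub> block_end m v
    \<longleftrightarrow> (u, v) \<in> B"
    (is "?s \<rightarrow>\<^sup>*\<^bsub>with_proj ?H\<^esub> ?t \<longleftrightarrow> _")
proof -
  interpret G: pair_digraph "block_graph n k m B"
    using pair_digraph_block_graph[OF n B] .
  have arcs_H: "parcs ?H = (path_arcs k m \<union> B) - cut_arcs k m u v"
    and verts_H: "pverts ?H = {..<n}"
    by (auto simp: delete_edges_def block_graph_def)
  have wf: "pair_wf_digraph ?H"
    using G.in_arcsD1 G.in_arcsD2 G.arc_fst_in_verts G.arc_snd_in_verts
    by unfold_locales (auto simp: delete_edges_def)
  interpret H: pair_wf_digraph ?H by (fact wf)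
  have u: "u < k * m" and v: "k * m \<le> v" "v < 2 * k * m" and uv_mod: "u mod m = v mod m"
    using uv by (auto simp: bit_arcs_def)
  have mod_Suc_ne: "Suc w mod m \<noteq> 0" if "w div m = Suc w div m" for w
  proof
    assume "Suc w mod m = 0"
    then have "Suc w = w div m * m"
      using div_mult_mod_eq[of "Suc w" m] that by (metis add.right_neutral)
    then show False using div_mult_mod_eq[of w m] by linarith
  qed
  have t_less: "?t < 2 * k * m"
  proof -
    have "v div m < 2 * k"
      using v m by (simp add: less_mult_imp_div_less)
    then have "Suc (v div m) * m \<le> 2 * k * m"
      by (intro mult_le_mono) auto
    then show ?thesis
      using m by (simp add: block_end_def)
  qed
  show ?thesis
  proof
    assume "(u, v) \<in> B"
    have "?s \<rightarrow>\<^sup>*\<^bsub>with_proj ?H\<^esub> u"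
    proof (rule reachable_along_successors[OF wf block_start_le])
      show "u \<in> pverts ?H" using u n by (simp add: verts_H)
      fix w assume w: "?s \<le> w" "w < u"
      then have "w div m = u div m" "Suc w div m = u div m"
        using block_end_ge[OF m, of u] by (auto intro!: div_eq_if_between_block_ends[OF m])
      then have "Suc w mod m \<noteq> 0" using mod_Suc_ne by simp
      \<comment> \<open>Neither cut hits this arc: \<open>w\<close> differs from \<open>u\<close>,
        and \<open>Suc w\<close> is still in the source half while \<open>v\<close> is in the target
        half.\<close>
      then show "(w, Suc w) \<in> parcs ?H"
        using w u v unfolding arcs_H by (auto simp: path_arcs_def cut_arcs_def)
    qed
    moreover have "(u, v) \<in> parcs ?H"
    proof -
      \<comment> \<open>A path arc changes the position modulo \<open>m\<close>, but
        \<open>u\<close> and \<open>v\<close> have the same position; hence cutting path arcs spares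
        the bit arc.\<close>
      have "(u, v) \<notin> path_arcs k m"
      proof
        assume "(u, v) \<in> path_arcs k m"
        then have "Suc u mod m = u mod m" "Suc u mod m \<noteq> 0"
          using uv_mod by (auto simp: path_arcs_def)
        then show False by (metis mod_Suc n_not_Suc_n)
      qed
      then show ?thesis
        using \<open>(u, v) \<in> B\<close> unfolding arcs_H by (auto simp: cut_arcs_def)
    qed
    moreover have "v \<rightarrow>\<^sup>*\<^bsub>with_proj ?H\<^esub> ?t"
    proof (rule reachable_along_successors[OF wf block_end_ge[OF m]])
      show "?t \<in> pverts ?H" using t_less n by (simp add: verts_H)
      fix w assume w: "v \<le> w" "w < ?t"
      then have "w div m = v div m" "Suc w div m = v div m"
        using block_start_le[of m v] by (auto intro!: div_eq_if_between_block_ends[OF m])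
      then have "Suc w mod m \<noteq> 0" using mod_Suc_ne by simp
      then show "(w, Suc w) \<in> parcs ?H"
        using w u v t_less unfolding arcs_H by (auto simp: path_arcs_def cut_arcs_def)
    qed
    ultimately show "?s \<rightarrow>\<^sup>*\<^bsub>with_proj ?H\<^esub> ?t"
      by (rule H.reachable_trans[OF _ H.adj_reachable_trans])
  next
    assume reach: "?s \<rightarrow>\<^sup>*\<^bsub>with_proj ?H\<^esub> ?t"
    show "(u, v) \<in> B"
    proof (rule ccontr)
      assume "(u, v) \<notin> B"
      \<comment> \<open>A superset of what is reachable when the bit is absent: the initial part of
        the block of \<open>u\<close>, and the target half without the segment from \<open>v\<close>
        to \<open>?t\<close>. A path arc could leave the former only at \<open>u\<close> and enter
        that segment only at \<open>v\<close>, where the cuts are.\<close>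
      define I where "I w \<longleftrightarrow> ?s \<le> w \<and> w \<le> u \<or> k * m \<le> w \<and> \<not> (v \<le> w \<and> w \<le> ?t)" for w
      have "I ?t"
      proof (rule reachable_closed[OF reach])
        show "I ?s" by (simp add: I_def block_start_le)
      next
        fix x y assume xy: "(x, y) \<in> parcs ?H" and "I x"
        then consider "(x, y) \<in> path_arcs k m" "(x, y) \<notin> cut_arcs k m u v" | "(x, y) \<in> B"
          by (auto simp: arcs_H)
        then show "I y"
        proof cases
          case 1
          then have "y = Suc x" "x \<noteq> u" "y \<noteq> v"
            by (auto simp: path_arcs_def cut_arcs_def)
          then show ?thesis using \<open>I x\<close> by (auto simp: I_def)
        next
          case 2
          then have xy: "x < k * m" "k * m \<le> y" "x mod m = y mod m"
            using B by (auto simp: bit_arcs_def)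
          then have x: "?s \<le> x" "x \<le> u"
            using \<open>I x\<close> by (auto simp: I_def)
          have False if y: "v \<le> y" "y \<le> ?t"
          proof -
            have "x div m = u div m" "y div m = v div m"
              using x y block_end_ge[OF m, of u] block_start_le[of m v]
              by (auto intro!: div_eq_if_between_block_ends[OF m])
            \<comment> \<open>A bit arc preserves positions, so
              \<open>x mod m \<le> u mod m = v mod m \<le> y mod m = x mod m\<close> forces equality
              throughout.\<close>
            then have "x mod m \<le> u mod m" "v mod m \<le> y mod m"
              using x y by (metis add_le_cancel_left div_mult_mod_eq)+
            then have "x = u" "y = v"
              using xy uv_mod \<open>x div m = u div m\<close> \<open>y div m = v div m\<close>
              by (metis div_mult_mod_eq le_antisym)+
            then show False using 2 \<open>(u, v) \<notin> B\<close> by simp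
          qed
          then show ?thesis using xy by (auto simp: I_def)
        qed
      qed
      then show False
        using u v block_end_ge[OF m, of v] by (auto simp: I_def)
    qed
  qed
qed

text \<open>Each probe under its cut reads off one bit. The right-hand side does not mention
  \<open>B\<close>, so for fixed \<open>Q\<close> one string cannot serve two different
  graphs.\<close>

lemma block_graph_determined_by_oracle:
  assumes "0 < m" "2 * k * m \<le> n" "B \<subseteq> bit_arcs k m" "probe_pairs k m \<subseteq> P"
    and "ft_reachability_oracle 2 (block_graph n k m B) P Q D"
  shows "B = {(u, v) \<in> bit_arcs k m. Q D (block_start m u, block_end m v) (cut_arcs k m u v)}"
proof -
  have "Q D (block_start m u, block_end m v) (cut_arcs k m u v) \<longleftrightarrow> (u, v) \<in> B"
    if uv: "(u, v) \<in> bit_arcs k m" for u v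
  proof -
    have "(block_start m u, block_end m v) \<in> P"
      using uv assms(4) by (auto simp: probe_pairs_def)
    moreover have "cut_arcs k m u v \<subseteq> parcs (block_graph n k m B)"
      by (auto simp: cut_arcs_def block_graph_def)
    moreover have "finite (cut_arcs k m u v)" "card (cut_arcs k m u v) \<le> 2"
    proof -
      have "card (cut_arcs k m u v) \<le> card {(u, Suc u), (v - 1, v)}"
        unfolding cut_arcs_def by (rule card_mono) auto
      also have "\<dots> \<le> 2" by (simp add: card_insert_if)
      finally show "card (cut_arcs k m u v) \<le> 2" .
    qed (simp add: cut_arcs_def)
    ultimately show ?thesis
      using assms(5) reachable_after_cut_iff[OF assms(1-3) uv]
      unfolding ft_reachability_oracle_def by blast
  qed
  then show ?thesis using assms(3) by auto
qed

section \<open>Counting bits against probe pairs\<close>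

lemma card_bit_arcs_ge:
  assumes "0 < m"
  shows "k * k * m \<le> card (bit_arcs k m)"
proof -
  \<comment> \<open>A triple stands for source block \<open>i\<close>, target block
    \<open>k + l\<close> and common position \<open>a\<close>.\<close>
  let ?f = "\<lambda>(i, l, a). (i * m + a, (k + l) * m + a)"
  let ?A = "{..<k} \<times> {..<k} \<times> {..<m}"
  have inj: "inj_on ?f ?A"
  proof (rule inj_onI, clarsimp)
    fix i l a i' l' a'
    assume a: "a < m" "a' < m" and eq: "i * m + a = i' * m + a'" "(k + l) * m + a = (k + l') * m + a'"
    have "(i * m + a) mod m = a" "(i' * m + a') mod m = a'" using a by auto
    then have "a = a'" using eq by simp
    then show "i = i' \<and> l = l' \<and> a = a'" using eq assms by simp
  qed
  have less: "i * m + a < j * m" if "i < j" "a < m" for i j a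
  proof -
    have "Suc i * m \<le> j * m" using that by (intro mult_le_mono) auto
    then show ?thesis using that by simp
  qed
  have "(i * m + a, (k + l) * m + a) \<in> bit_arcs k m" if "i < k" "l < k" "a < m" for i l a
  proof -
    have "((k + l) * m + a) mod m = a" "(i * m + a) mod m = a"
      using that by simp_all
    then show ?thesis
      using that less[of i k a] less[of "k + l" "2 * k" a]
      unfolding bit_arcs_def by (simp add: add_mult_distrib)
  qed
  then have "?f ` ?A \<subseteq> bit_arcs k m" by auto
  then have "card ?A \<le> card (bit_arcs k m)"
    using inj finite_bit_arcs by (intro card_inj_on_le)
  then show ?thesis by (simp add: card_cartesian_product mult.assoc)
qed

text \<open>A probe pair remembers only the two blocks, not the position, so all \<open>m\<close>
  bits between two blocks share one pair.\<close>

lemma card_probe_pairs_le: "card (probe_pairs k m) \<le> k * k"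
proof -
  have "probe_pairs k m \<subseteq> (\<lambda>i. i * m) ` {..<k} \<times> (\<lambda>l. l * m + (m - 1)) ` {k..<2 * k}"
    (is "_ \<subseteq> ?S \<times> ?T")
  proof -
    have "(block_start m u, block_end m v) \<in> ?S \<times> ?T" if uv: "(u, v) \<in> bit_arcs k m" for u v
    proof -
      have "0 < m" using uv by (cases m) (auto simp: bit_arcs_def)
      with uv have "u div m < k" "k \<le> v div m" "v div m < 2 * k"
        by (auto simp: bit_arcs_def less_mult_imp_div_less less_eq_div_iff_mult_less_eq)
      then show ?thesis
        unfolding block_start_def block_end_def by (intro SigmaI imageI) auto
    qed
    then show ?thesis unfolding probe_pairs_def by auto
  qed
  then have "card (probe_pairs k m) \<le> card ?S * card ?T"
    using card_mono[of "?S \<times> ?T"] by (simp add: card_cartesian_product)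
  also have "\<dots> \<le> k * k"
    using card_image_le[of "{..<k}" "\<lambda>i. i * m"]
      card_image_le[of "{k..<2 * k}" "\<lambda>l. l * m + (m - 1)"]
    by (intro mult_le_mono) auto
  finally show ?thesis .
qed

lemma probe_pairs_subset:
  assumes "0 < m" "2 * k * m \<le> n"
  shows "probe_pairs k m \<subseteq> {..<n} \<times> {..<n}"
proof (clarsimp simp: probe_pairs_def)
  fix u v assume uv: "(u, v) \<in> bit_arcs k m"
  then have "v div m < 2 * k"
    by (auto simp: bit_arcs_def intro: less_mult_imp_div_less)
  then have "Suc (v div m) * m \<le> 2 * k * m"
    by (intro mult_le_mono) auto
  then have "block_end m v < n"
    using assms by (simp add: block_end_def)
  moreover have "block_start m u < n"
    using uv assms block_start_le[of m u] by (auto simp: bit_arcs_def)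
  ultimately show "block_start m u < n \<and> block_end m v < n" by simp
qed

lemma exists_graph_with_long_oracles:
  assumes "0 < m" "2 * k * m \<le> n" "probe_pairs k m \<subseteq> P"
  shows "\<exists>G. pair_digraph G \<and> pverts G = {..<n} \<and>
    (\<forall>D. ft_reachability_oracle 2 G P Q D \<longrightarrow> k * k * m \<le> length D)"
proof -
  have "\<exists>B\<in>Pow (bit_arcs k m). \<forall>D. ft_reachability_oracle 2 (block_graph n k m B) P Q D
      \<longrightarrow> k * k * m \<le> length D"
  proof (rule exists_long_code)
    show "finite (Pow (bit_arcs k m))" "2 ^ (k * k * m) \<le> card (Pow (bit_arcs k m))"
      using card_bit_arcs_ge[OF assms(1)] by (simp_all add: finite_bit_arcs card_Pow)
    show "B = B'" if "B \<in> Pow (bit_arcs k m)" "B' \<in> Pow (bit_arcs k m)"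
      "ft_reachability_oracle 2 (block_graph n k m B) P Q D"
      "ft_reachability_oracle 2 (block_graph n k m B') P Q D" for B B' D
      using block_graph_determined_by_oracle[OF assms(1,2) PowD[OF that(1)] assms(3) that(3)]
        block_graph_determined_by_oracle[OF assms(1,2) PowD[OF that(2)] assms(3) that(4)]
      by (rule trans[OF _ sym])
  qed
  then obtain B where B: "B \<subseteq> bit_arcs k m"
    "\<forall>D. ft_reachability_oracle 2 (block_graph n k m B) P Q D \<longrightarrow> k * k * m \<le> length D"
    by blast
  then show ?thesis
    using pair_digraph_block_graph[OF assms(2) B(1)]
    by (intro exI[of _ "block_graph n k m B"]) (simp add: block_graph_def)
qed

section \<open>Choosing the number and length of blocks\<close>

lemma exists_block_parameters:
  assumes "2 \<le> n" "0 < r" "r \<le> n\<^sup>2"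
  obtains k m :: nat where "0 < m" "2 * k * m \<le> n" "k * k \<le> r"
    "1 / 12 * real n * sqrt (real r) \<le> real (k * k * m)"
proof -
  define q where "q = nat \<lfloor>sqrt (real r)\<rfloor>"
  \<comment> \<open>The cap \<open>n div 2\<close> leaves room for \<open>2 * k\<close> nonempty
    blocks when \<open>sqrt r\<close> exceeds it. The constant is 12 = 3 * 4, from
    \<open>sqrt r \<le> 3 * k\<close> and \<open>n \<le> 4 * k * m\<close>.\<close>
  define k where "k = min q (n div 2)"
  define m where "m = n div (2 * k)"
  have sqrt_ge: "1 \<le> sqrt (real r)" using assms(2) by simp
  then have q: "1 \<le> q" "real q \<le> sqrt (real r)" "sqrt (real r) < real q + 1"
    by (auto simp: q_def le_nat_floor)
  have k: "1 \<le> k" "2 * k \<le> n" using q(1) assms(1) by (auto simp: k_def)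
  then have "0 < m" by (simp add: m_def div_greater_zero_iff)
  moreover have "2 * k * m + n mod (2 * k) = n"
    by (simp add: m_def)
  moreover have "n mod (2 * k) < 2 * k" using k by simp
  ultimately have m: "0 < m" "2 * k * m \<le> n" "n < 2 * k * m + 2 * k"
    by linarith+
  have "real (k * k) \<le> (sqrt (real r))\<^sup>2"
    using q(2) unfolding power2_eq_square of_nat_mult
    by (intro mult_mono) (auto simp: k_def)
  then have kk: "k * k \<le> r" by (simp flip: of_nat_mult)
  have "sqrt (real r) \<le> real n"
    using assms(3) by (intro real_le_lsqrt) (auto simp flip: of_nat_power)
  \<comment> \<open>The factor 3 is attained at \<open>n = 3\<close>; in the uncapped case
    \<open>sqrt r < q + 1 \<le> 2 * q\<close> suffices.\<close>
  moreover have "n \<le> 3 * (n div 2)" using assms(1) by presburger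
  then have "real n \<le> 3 * real (n div 2)" by linarith
  ultimately have "sqrt (real r) \<le> 3 * real k"
    using q by (auto simp: k_def min_def)
  moreover have "real n \<le> 4 * real (k * m)"
  proof -
    have "k \<le> k * m" using m(1) by simp
    then have "n \<le> 4 * (k * m)" using m(3) by linarith
    then show ?thesis by linarith
  qed
  ultimately have "real n * sqrt (real r) \<le> (4 * real (k * m)) * (3 * real k)"
    by (intro mult_mono) auto
  then have "1 / 12 * real n * sqrt (real r) \<le> real (k * k * m)" by (simp add: mult.commute mult.left_commute)
  with m kk show thesis by (intro that)
qed

(* Since Q is not charged for its size, it has to be fixed before the hard graph
   is chosen: a Q depending on G could answer all queries from the empty string.
   Q may still depend on n, r and P.  For n = 1 the only query has the answer
   True, so no bits are needed; this is the only case excluded from the bound. *)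
theorem theorem1p2:
  shows "\<exists>c::real. c > 0 \<and>
    (\<forall>n r :: nat. 0 < n \<and> 0 < r \<and> r \<le> n\<^sup>2 \<longrightarrow>
      (\<exists>P :: (nat \<times> nat) set. P \<subseteq> {..<n} \<times> {..<n} \<and> card P = r \<and>
        (\<forall>Q :: nat query_procedure.
          \<exists>G :: nat pair_pre_digraph. pair_digraph G \<and> pverts G = {..<n} \<and>
            (\<forall>D. ft_reachability_oracle 2 G P Q D \<longrightarrow>
              (2 \<le> n \<longrightarrow> c * real n * sqrt (real (card P)) \<le> real (length D))))))"
proof (intro exI[of _ "1 / 12 :: real"] conjI allI impI)
  fix n r :: nat
  assume nr: "0 < n \<and> 0 < r \<and> r \<le> n\<^sup>2"
  have card_all: "card ({..<n} \<times> {..<n}) = n\<^sup>2"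
    by (simp add: card_cartesian_product power2_eq_square)
  obtain k m where km: "0 < m" "2 * k * m \<le> n" "k * k \<le> r"
    "2 \<le> n \<Longrightarrow> 1 / 12 * real n * sqrt (real r) \<le> real (k * k * m)"
  proof (cases "2 \<le> n")
    case True
    then show thesis using nr exists_block_parameters[of n r] that by blast
  next
    case False
    \<comment> \<open>Here \<open>m = 1\<close> and \<open>k = 0\<close>: no bits and no probes, as
      the bound is claimed only for \<open>2 \<le> n\<close>.\<close>
    then show thesis using that[of 1 0] by simp
  qed
  have "card (probe_pairs k m) \<le> r"
    using card_probe_pairs_le km(3) by (rule le_trans)
  \<comment> \<open>Padding the probe pairs to exactly \<open>r\<close> pairs only adds demands on
    the oracle.\<close>
  then obtain P where P: "probe_pairs k m \<subseteq> P" "P \<subseteq> {..<n} \<times> {..<n}" "card P = r"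
    using exists_subset_between[OF _ _ probe_pairs_subset[OF km(1,2)], of r] nr card_all by auto
  have "\<exists>G. pair_digraph G \<and> pverts G = {..<n} \<and>
      (\<forall>D. ft_reachability_oracle 2 G P Q D \<longrightarrow>
        (2 \<le> n \<longrightarrow> 1 / 12 * real n * sqrt (real (card P)) \<le> real (length D)))" for Q
    using exists_graph_with_long_oracles[OF km(1,2) P(1), of Q] km(4) P(3)
    by (meson of_nat_le_iff order_trans)
  with P show "\<exists>P. P \<subseteq> {..<n} \<times> {..<n} \<and> card P = r \<and>
      (\<forall>Q. \<exists>G. pair_digraph G \<and> pverts G = {..<n} \<and>
        (\<forall>D. ft_reachability_oracle 2 G P Q D \<longrightarrow>
          (2 \<le> n \<longrightarrow> 1 / 12 * real n * sqrt (real (card P)) \<le> real (length D))))"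
    by blast
qed simp

end
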